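(* Let $Z^\bullet$ and $Y^\bullet$ be filtered simplicial complexes on a common vertex set $P$, such that the final level $Y^N$ of $Y^\bullet$ is the complete simplex on $P$. Fix a parameter $\psi$ of $Z^\bullet$ and a homology class $[\tau]\in\widetilde H_k(Z^\psi)$. The output of the cycle-to-cycles extension algorithm (described in the context) suffices to recover all cycle extensions of $[\tau]$. That is, let $E=\bigcup_\ell E_\ell$ be the set of all cycle extensions of $[\tau]$, and let $p_Y$ and $\mathfrak E=\bigcup_{\ell\in p_Y}\mathfrak E_\ell$ be the outputs of the algorithm (all as defined in the context). For parameters $\ell\le\ell'$ let $\lambda^\ell_{\ell'}:\widetilde H_k(Y^\ell)\to\widetilde H_k(Y^{\ell'})$ be the map induced by inclusion, and let $$\mathfrak E^*=\{[y]\in\widetilde H_k(Y^{\ell'})\;|\;\text{there exist } \ell\in p_Y \text{ and } [y_\ell]\in\mathfrak E_\ell \text{ such that } [y]=\lambda^\ell_{\ell'}([y_\ell])\},$$ where $\ell'$ ranges over all parameters $1\le\ell'\le N$ and $\ell\le\ell'$. Then $E=\mathfrak E^*$. (Both are regarded as collections of classes tagged by the parameter at which they live.)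
   Context: Fix a finite field $\mathbb F$ and an integer $k\ge 0$. All complexes are finite and nonempty; $\widetilde H_k$ is reduced homology with coefficients in $\mathbb F$. Persistence and barcodes. A filtered simplicial complex is a nested sequence $X^1\subseteq\dots\subseteq X^N$. Its persistent homology $P\widetilde H_k(X^\bullet)$ is the persistence module (a $\mathbb Z$-graded vector space with linear structure maps from degree $\ell$ to degree $\ell+1$) whose degree-$\ell$ part is $\widetilde H_k(X^\ell)$ for $1\le \ell\le N$ and $0$ otherwise, with structure maps induced by inclusion (zero elsewhere). Morphisms of persistence modules are families of linear maps commuting with structure maps. The interval module $I[\beta,\delta)$ is $\mathbb F$ in degrees $\beta\le\ell<\delta$ and $0$ elsewhere, with identity maps between consecutive copies of $\mathbb F$. The barcode of $X^\bullet$ is a finite set $\mathrm{bc}_k(X^\bullet)$ of bars with birth and death functions $\beta<\delta$ into $\mathbb Z$, unique up to isomorphism, for which there is an isomorphism $\mathcal B:\bigoplus_{\rho\in \mathrm{bc}_k(X^\bullet)}I[\beta(\rho),\delta(\rho))\to P\widetilde H_k(X^\bullet)$; any such isomorphism is called an interval decomposition. A death value $N+1$ is written $\infty$. It is assumed that distinct bars of a barcode have distinct (birth, death) pairs. For a bar $\rho$ with $\beta(\rho)\le\ell<\delta(\rho)$, $\vec e^{\,\ell}_\rho$ is the standard basis vector of the $\rho$-summand in degree $\ell$, and $[\rho^{\mathcal B,\ell}]=\mathcal B^\ell(\vec e^{\,\ell}_\rho)\in\widetilde H_k(X^\ell)$. The $\mathcal B$-bar representation at $\ell$ of a class $[z]\in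 \widetilde H_k(X^\ell)$ is the set $\{c_1\rho_1,\dots,c_K\rho_K\}$ where $\rho_i$ are distinct bars alive at $\ell$, all $c_i\ne 0$, and $[z]=\sum_i c_i[\rho_i^{\mathcal B,\ell}]$. Restrictions and cycle extensions. For a parameter $1\le\ell\le N$ of $Y^\bullet$ let $\widetilde H_k(Z^\psi)\xleftarrow{\chi_\ell}\widetilde H_k(Z^\psi\cap Y^\ell)\xrightarrow{\Upsilon_\ell}\widetilde H_k(Y^\ell)$ be the maps induced by inclusion. The set of restrictions of $[\tau]$ at $\ell$ is $R_\ell=\{[w]\in\widetilde H_k(Z^\psi\cap Y^\ell)\,|\,\chi_\ell[w]=[\tau]\}$; the set of cycle extensions of $[\tau]$ at $\ell$ is $E_\ell=\{\Upsilon_\ell[w]\,|\,[w]\in R_\ell\}$; and $E=\bigcup_\ell E_\ell$. Cycle-to-cycles extension algorithm. Input: $Z^\bullet$, $Y^\bullet$, $\psi$, $[\tau]\in \widetilde H_k(Z^\psi)$. (1) Form the auxiliary filtration $Z^\psi\cap Y^1\subseteq\dots\subseteq Z^\psi\cap Y^N=Z^\psi$, denoted $Z^\psi\cap Y^\bullet$, with barcode $(\mathrm{bc}_k(Z^\psi\cap Y^\bullet),\hat\beta,\hat\delta)$, and compute an interval decomposition $\mathcal F$ of $P\widetilde H_k(Z^\psi\cap Y^\bullet)$. (2) Let $\{f_1^*\rho_1,\dots,f_m^*\rho_m\}$ be the $\mathcal F$-bar representation of $[\tau]$ at $N$, let $\mathrm{BARS}^{\mathcal F}_\tau=\{\rho_1,\dots,\rho_m\}$,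 $\ell_0=\max_{\rho\in \mathrm{BARS}^{\mathcal F}_\tau}\hat\beta(\rho)$, $\omega=\{\mu\in\mathrm{bc}_k(Z^\psi\cap Y^\bullet)\,|\,\ell_0<\hat\beta(\mu)<\hat\delta(\mu)<\infty\}$, and $p_Y=\{\ell_0\}\cup\{\hat\beta(\mu)\,|\,\mu\in\omega\}$. (3) Let $\mathrm{BARS}_{\text{short}}=\{\rho\in\mathrm{bc}_k(Z^\psi\cap Y^\bullet)\,|\,\ell_0<\hat\delta(\rho)<\infty\}$. For each $\ell\in p_Y$ let $\mathrm{BARS}^\ell_{\text{short}}=\{\rho\in\mathrm{BARS}_{\text{short}}\,|\,\hat\beta(\rho)\le\ell<\hat\delta(\rho)<\infty\}$, $V^\ell_{\text{short}}=\{[\rho^{\mathcal F,\ell}]\,|\,\rho\in\mathrm{BARS}^\ell_{\text{short}}\}$, $\mathfrak R^{\mathcal F}_\ell=\sum_{i=1}^m f_i^*[\rho_i^{\mathcal F,\ell}]+\mathrm{span}_{\mathbb F}V^\ell_{\text{short}}$, and $\mathfrak E_\ell=\{\Upsilon_\ell([w])\,|\,[w]\in\mathfrak R^{\mathcal F}_\ell\}$. (4) Return $p_Y$ and $\mathfrak E=\bigcup_{\ell\in p_Y}\mathfrak E_\ell$. *)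

theory Defs
  imports "HOL-Algebra.Module" "HOL-Algebra.AbelCoset" "HOL-Library.Poly_Mapping"
begin

section \<open>Vector spaces\<close>

text \<open>
  Vector spaces over the field \<open>'f\<close> are \<^type>\<open>module\<close> records over the ring
  \<open>field_ring\<close>. The fields \<open>mult\<close> and \<open>one\<close>, which the record type inherits from
  rings, play no role and are left \<open>undefined\<close>.
\<close>

definition field_ring :: "('f::field) ring" where
  "field_ring = \<lparr>carrier = UNIV, mult = (*), one = 1, zero = 0, add = (+)\<rparr>"

definition zero_module :: "'a \<Rightarrow> ('f, 'a) module" where
  "zero_module z = \<lparr>carrier = {z}, mult = undefined, one = undefined, zero = z,
     add = (\<lambda>_ _. z), smult = (\<lambda>_ _. z)\<rparr>"

definition linear_maps :: "('f, 'a) module \<Rightarrow> ('f, 'b) module \<Rightarrow> ('a \<Rightarrow> 'b) set" where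
  "linear_maps M M' = {g \<in> carrier M \<rightarrow> carrier M'.
     (\<forall>x\<in>carrier M. \<forall>y\<in>carrier M. g (x \<oplus>\<^bsub>M\<^esub> y) = g x \<oplus>\<^bsub>M'\<^esub> g y) \<and>
     (\<forall>a. \<forall>x\<in>carrier M. g (a \<odot>\<^bsub>M\<^esub> x) = a \<odot>\<^bsub>M'\<^esub> g x)}"

definition lin_span :: "('f, 'a) module \<Rightarrow> 'a set \<Rightarrow> 'a set" where
  "lin_span M V = {\<Oplus>\<^bsub>M\<^esub>v\<in>A. c v \<odot>\<^bsub>M\<^esub> v | A c. finite A \<and> A \<subseteq> V}"

text \<open>The elements of the quotient are the cosets of \<open>H\<close>, as for \<^const>\<open>A_FactGroup\<close>.\<close>

definition quotient_module :: "('f, 'a) module \<Rightarrow> 'a set \<Rightarrow> ('f, 'a set) module" where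
  "quotient_module M H = \<lparr>carrier = a_rcosets\<^bsub>M\<^esub> H, mult = undefined, one = undefined,
     zero = H, add = set_add M, smult = (\<lambda>a A. \<Union>x\<in>A. H +>\<^bsub>M\<^esub> (a \<odot>\<^bsub>M\<^esub> x))\<rparr>"


section \<open>Simplicial complexes and reduced homology\<close>

text \<open>Simplices are nonempty finite vertex sets; the empty simplex is not a member of a complex.\<close>

definition simplicial_complex :: "'v set set \<Rightarrow> bool" where
  "simplicial_complex K \<longleftrightarrow> finite K \<and> K \<noteq> {} \<and>
     (\<forall>\<sigma>\<in>K. finite \<sigma> \<and> \<sigma> \<noteq> {} \<and> (\<forall>\<tau>. \<tau> \<subseteq> \<sigma> \<and> \<tau> \<noteq> {} \<longrightarrow> \<tau> \<in> K))"

text \<open>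
  The linear order on the vertex type only serves to orient the simplices. A chain is a
  formal linear combination of simplices, a \<open>k\<close>-simplex having \<open>k + 1\<close> vertices.
\<close>

definition chain_space :: "nat \<Rightarrow> 'v set set \<Rightarrow> ('v set \<Rightarrow>\<^sub>0 'f::field) set" where
  "chain_space k K = {c. Poly_Mapping.keys c \<subseteq> {\<sigma> \<in> K. card \<sigma> = Suc k}}"

definition chain_smult :: "'f \<Rightarrow> ('v set \<Rightarrow>\<^sub>0 'f::field) \<Rightarrow> ('v set \<Rightarrow>\<^sub>0 'f)" where
  "chain_smult a c = Poly_Mapping.map ((*) a) c"

text \<open>
  If \<open>v\<close> is the \<open>i\<close>-th vertex of \<open>\<sigma>\<close>, counting from \<open>0\<close>, then \<open>i = card {u \<in> \<sigma>. u < v}\<close>.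
  The boundary of a vertex is the empty simplex, so on \<open>0\<close>-chains \<open>boundary\<close> is the
  augmentation, and \<open>cycle_module 0\<close> consists of the \<open>0\<close>-chains of coefficient sum zero.
  This makes \<open>homology\<close> below reduced homology.
\<close>

definition boundary :: "('v::linorder set \<Rightarrow>\<^sub>0 'f::field) \<Rightarrow> ('v set \<Rightarrow>\<^sub>0 'f)" where
  "boundary c = (\<Sum>\<sigma>\<in>Poly_Mapping.keys c. \<Sum>v\<in>\<sigma>.
     Poly_Mapping.single (\<sigma> - {v}) ((-1) ^ card {u \<in> \<sigma>. u < v} * Poly_Mapping.lookup c \<sigma>))"

definition cycle_module ::
    "nat \<Rightarrow> 'v::linorder set set \<Rightarrow> ('f::field, 'v set \<Rightarrow>\<^sub>0 'f) module" where
  "cycle_module k K = \<lparr>carrier = {c \<in> chain_space k K. boundary c = 0}, mult = undefined,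
     one = undefined, zero = 0, add = (+), smult = chain_smult\<rparr>"

definition boundaries :: "nat \<Rightarrow> 'v::linorder set set \<Rightarrow> ('v set \<Rightarrow>\<^sub>0 'f::field) set" where
  "boundaries k K = boundary ` chain_space (Suc k) K"

type_synonym ('v, 'f) hclass = "('v set \<Rightarrow>\<^sub>0 'f) set"

definition homology ::
    "nat \<Rightarrow> 'v::linorder set set \<Rightarrow> ('f::field, ('v, 'f) hclass) module" where
  "homology k K = quotient_module (cycle_module k K) (boundaries k K)"

text \<open>
  The map on homology induced by an inclusion into the complex \<open>L\<close>: the class of \<open>z\<close> is
  sent to the class of \<open>z\<close> in \<open>L\<close>.
\<close>

definition incl_map ::
    "nat \<Rightarrow> 'v::linorder set set \<Rightarrow> ('v, 'f::field) hclass \<Rightarrow> ('v, 'f) hclass" where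
  "incl_map k L A = (\<Union>z\<in>A. boundaries k L +>\<^bsub>cycle_module k L\<^esub> z)"


section \<open>Persistence modules and barcodes\<close>

record ('f, 'a) pmodule =
  deg :: "int \<Rightarrow> ('f, 'a) module"
  str :: "int \<Rightarrow> 'a \<Rightarrow> 'a"  \<comment> \<open>\<open>str M l\<close> maps degree \<open>l\<close> to degree \<open>l + 1\<close>\<close>

definition persistence_module :: "('f::field, 'a) pmodule \<Rightarrow> bool" where
  "persistence_module M \<longleftrightarrow> (\<forall>l. module field_ring (deg M l) \<and>
     str M l \<in> linear_maps (deg M l) (deg M (l + 1)))"

definition pmodule_morphism ::
    "('f, 'a) pmodule \<Rightarrow> ('f, 'b) pmodule \<Rightarrow> (int \<Rightarrow> 'a \<Rightarrow> 'b) \<Rightarrow> bool" where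
  "pmodule_morphism M M' g \<longleftrightarrow> (\<forall>l. g l \<in> linear_maps (deg M l) (deg M' l) \<and>
     (\<forall>x\<in>carrier (deg M l). g (l + 1) (str M l x) = str M' l (g l x)))"

definition pmodule_iso ::
    "('f, 'a) pmodule \<Rightarrow> ('f, 'b) pmodule \<Rightarrow> (int \<Rightarrow> 'a \<Rightarrow> 'b) \<Rightarrow> bool" where
  "pmodule_iso M M' g \<longleftrightarrow> pmodule_morphism M M' g \<and>
     (\<forall>l. bij_betw (g l) (carrier (deg M l)) (carrier (deg M' l)))"

definition interval_pmodule :: "int \<Rightarrow> int \<Rightarrow> ('f::field, 'f) pmodule" where
  "interval_pmodule b d = \<lparr>
     deg = (\<lambda>l. if b \<le> l \<and> l < d
       then \<lparr>carrier = UNIV, mult = undefined, one = undefined, zero = 0, add = (+), smult = (*)\<rparr>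
       else zero_module 0),
     str = (\<lambda>l x. if b \<le> l \<and> l + 1 < d then x else 0)\<rparr>"

text \<open>Only used for finite \<open>A\<close>, where the direct sum is the direct product.\<close>

definition pmodule_sum ::
    "'b set \<Rightarrow> ('b \<Rightarrow> ('f, 'a) pmodule) \<Rightarrow> ('f, 'b \<Rightarrow> 'a) pmodule" where
  "pmodule_sum A M = \<lparr>
     deg = (\<lambda>l. \<lparr>carrier = (\<Pi>\<^sub>E i\<in>A. carrier (deg (M i) l)), mult = undefined, one = undefined,
       zero = (\<lambda>i\<in>A. \<zero>\<^bsub>deg (M i) l\<^esub>),
       add = (\<lambda>x y. \<lambda>i\<in>A. x i \<oplus>\<^bsub>deg (M i) l\<^esub> y i),
       smult = (\<lambda>a x. \<lambda>i\<in>A. a \<odot>\<^bsub>deg (M i) l\<^esub> x i)\<rparr>),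
     str = (\<lambda>l x. \<lambda>i\<in>A. str (M i) l (x i))\<rparr>"

text \<open>A filtration of length \<open>N\<close> is a family of complexes; only the indices \<open>1..N\<close> matter.\<close>

type_synonym 'v filtration = "int \<Rightarrow> 'v set set"

definition filtered_complex :: "'v set \<Rightarrow> int \<Rightarrow> 'v filtration \<Rightarrow> bool" where
  "filtered_complex P N X \<longleftrightarrow> 1 \<le> N \<and>
     (\<forall>l\<in>{1..N}. simplicial_complex (X l) \<and> \<Union> (X l) \<subseteq> P) \<and>
     (\<forall>l\<in>{1..<N}. X l \<subseteq> X (l + 1))"

definition complete_simplex :: "'v set \<Rightarrow> 'v set set" where
  "complete_simplex P = {\<sigma>. \<sigma> \<subseteq> P \<and> \<sigma> \<noteq> {}}"

definition persistent_homology ::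
    "nat \<Rightarrow> int \<Rightarrow> 'v::linorder filtration \<Rightarrow> ('f::field, ('v, 'f) hclass) pmodule" where
  "persistent_homology k N X = \<lparr>
     deg = (\<lambda>l. if l \<in> {1..N} then homology k (X l) else zero_module {0}),
     str = (\<lambda>l x. if l \<in> {1..<N} then incl_map k (X (l + 1)) x
       else \<zero>\<^bsub>if l + 1 \<in> {1..N} then homology k (X (l + 1)) else zero_module {0}\<^esub>)\<rparr>"

record 'b barcode =
  bars :: "'b set"
  birth :: "'b \<Rightarrow> int"
  death :: "'b \<Rightarrow> int"

text \<open>For a filtration of length \<open>N\<close>, the death value \<open>N + 1\<close> plays the role of infinity.\<close>

definition interval_decomposition ::
    "nat \<Rightarrow> int \<Rightarrow> 'v::linorder filtration \<Rightarrow> 'b barcode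
      \<Rightarrow> (int \<Rightarrow> ('b \<Rightarrow> 'f::field) \<Rightarrow> ('v, 'f) hclass) \<Rightarrow> bool" where
  "interval_decomposition k N X B F \<longleftrightarrow>
     finite (bars B) \<and> (\<forall>\<rho>\<in>bars B. birth B \<rho> < death B \<rho>) \<and>
     pmodule_iso (pmodule_sum (bars B) (\<lambda>\<rho>. interval_pmodule (birth B \<rho>) (death B \<rho>)))
       (persistent_homology k N X) F"

definition alive_bars :: "'b barcode \<Rightarrow> int \<Rightarrow> 'b set" where
  "alive_bars B l = {\<rho> \<in> bars B. birth B \<rho> \<le> l \<and> l < death B \<rho>}"

definition bar_class ::
    "'b barcode \<Rightarrow> (int \<Rightarrow> ('b \<Rightarrow> 'f::field) \<Rightarrow> ('v, 'f) hclass) \<Rightarrow> int \<Rightarrow> 'b \<Rightarrow> ('v, 'f) hclass"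
  where
  "bar_class B F l \<rho> = F l (\<lambda>\<mu>\<in>bars B. if \<mu> = \<rho> then 1 else 0)"

text \<open>
  The bar representation \<open>{c \<rho> \<rho> | \<rho> \<in> S}\<close> of the class \<open>z\<close> at \<open>l\<close> is given by its set \<open>S\<close>
  of bars and its coefficients \<open>c\<close>.
\<close>

definition bar_representation ::
    "nat \<Rightarrow> 'v::linorder filtration \<Rightarrow> 'b barcode \<Rightarrow> (int \<Rightarrow> ('b \<Rightarrow> 'f::field) \<Rightarrow> ('v, 'f) hclass)
      \<Rightarrow> int \<Rightarrow> ('v, 'f) hclass \<Rightarrow> 'b set \<Rightarrow> ('b \<Rightarrow> 'f) \<Rightarrow> bool" where
  "bar_representation k X B F l z S c \<longleftrightarrow>
     S \<subseteq> alive_bars B l \<and> (\<forall>\<rho>\<in>S. c \<rho> \<noteq> 0) \<and>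
     z = (\<Oplus>\<^bsub>homology k (X l)\<^esub>\<rho>\<in>S. c \<rho> \<odot>\<^bsub>homology k (X l)\<^esub> bar_class B F l \<rho>)"


section \<open>Cycle extensions\<close>

definition restrictions ::
    "nat \<Rightarrow> 'v::linorder set set \<Rightarrow> 'v filtration \<Rightarrow> ('v, 'f::field) hclass \<Rightarrow> int
      \<Rightarrow> ('v, 'f) hclass set" where
  "restrictions k Z Y t l = {w \<in> carrier (homology k (Z \<inter> Y l)). incl_map k Z w = t}"

definition extensions_at ::
    "nat \<Rightarrow> 'v::linorder set set \<Rightarrow> 'v filtration \<Rightarrow> ('v, 'f::field) hclass \<Rightarrow> int
      \<Rightarrow> ('v, 'f) hclass set" where
  "extensions_at k Z Y t l = incl_map k (Y l) ` restrictions k Z Y t l"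

text \<open>Classes are tagged by the parameter at which they live.\<close>

definition cycle_extensions ::
    "nat \<Rightarrow> int \<Rightarrow> 'v::linorder set set \<Rightarrow> 'v filtration \<Rightarrow> ('v, 'f::field) hclass
      \<Rightarrow> (int \<times> ('v, 'f) hclass) set" where
  "cycle_extensions k N Z Y t = (SIGMA l:{1..N}. extensions_at k Z Y t l)"


section \<open>The cycle-to-cycles extension algorithm\<close>

text \<open>
  Below, \<open>Z\<close> is the single complex \<open>Z\<^sup>\<psi>\<close>, \<open>B\<close> is the barcode of the auxiliary filtration,
  \<open>F\<close> an interval decomposition, and \<open>S\<close>, \<open>f\<close> the bars and coefficients of the bar
  representation of the input class at \<open>N\<close>.
\<close>

definition aux_filtration :: "'v set set \<Rightarrow> 'v filtration \<Rightarrow> 'v filtration" where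
  "aux_filtration Z Y l = Z \<inter> Y l"

text \<open>
  \<open>S\<close> is empty iff the input class is zero; the maximum of no parameters is then the least
  parameter \<open>1\<close>.
\<close>

definition ell0 :: "'b barcode \<Rightarrow> 'b set \<Rightarrow> int" where
  "ell0 B S = (if S = {} then 1 else Max (birth B ` S))"

definition omega_bars :: "int \<Rightarrow> 'b barcode \<Rightarrow> 'b set \<Rightarrow> 'b set" where
  "omega_bars N B S = {\<mu> \<in> bars B.
     ell0 B S < birth B \<mu> \<and> birth B \<mu> < death B \<mu> \<and> death B \<mu> < N + 1}"

definition p_params :: "int \<Rightarrow> 'b barcode \<Rightarrow> 'b set \<Rightarrow> int set" where
  "p_params N B S = {ell0 B S} \<union> birth B ` omega_bars N B S"

definition short_bars :: "int \<Rightarrow> 'b barcode \<Rightarrow> 'b set \<Rightarrow> 'b set" where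
  "short_bars N B S = {\<rho> \<in> bars B. ell0 B S < death B \<rho> \<and> death B \<rho> < N + 1}"

definition short_bars_at :: "int \<Rightarrow> 'b barcode \<Rightarrow> 'b set \<Rightarrow> int \<Rightarrow> 'b set" where
  "short_bars_at N B S l = {\<rho> \<in> short_bars N B S.
     birth B \<rho> \<le> l \<and> l < death B \<rho> \<and> death B \<rho> < N + 1}"

definition alg_restrictions ::
    "nat \<Rightarrow> int \<Rightarrow> 'v::linorder set set \<Rightarrow> 'v filtration \<Rightarrow> 'b barcode
      \<Rightarrow> (int \<Rightarrow> ('b \<Rightarrow> 'f::field) \<Rightarrow> ('v, 'f) hclass) \<Rightarrow> 'b set \<Rightarrow> ('b \<Rightarrow> 'f) \<Rightarrow> int
      \<Rightarrow> ('v, 'f) hclass set" where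
  "alg_restrictions k N Z Y B F S f l =
     (let H = homology k (aux_filtration Z Y l) in
      {(\<Oplus>\<^bsub>H\<^esub>\<rho>\<in>S. f \<rho> \<odot>\<^bsub>H\<^esub> bar_class B F l \<rho>) \<oplus>\<^bsub>H\<^esub> s | s.
         s \<in> lin_span H (bar_class B F l ` short_bars_at N B S l)})"

definition alg_extensions_at ::
    "nat \<Rightarrow> int \<Rightarrow> 'v::linorder set set \<Rightarrow> 'v filtration \<Rightarrow> 'b barcode
      \<Rightarrow> (int \<Rightarrow> ('b \<Rightarrow> 'f::field) \<Rightarrow> ('v, 'f) hclass) \<Rightarrow> 'b set \<Rightarrow> ('b \<Rightarrow> 'f) \<Rightarrow> int
      \<Rightarrow> ('v, 'f) hclass set" where
  "alg_extensions_at k N Z Y B F S f l =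
     incl_map k (Y l) ` alg_restrictions k N Z Y B F S f l"

definition alg_extensions ::
    "nat \<Rightarrow> int \<Rightarrow> 'v::linorder set set \<Rightarrow> 'v filtration \<Rightarrow> 'b barcode
      \<Rightarrow> (int \<Rightarrow> ('b \<Rightarrow> 'f::field) \<Rightarrow> ('v, 'f) hclass) \<Rightarrow> 'b set \<Rightarrow> ('b \<Rightarrow> 'f)
      \<Rightarrow> (int \<times> ('v, 'f) hclass) set" where
  "alg_extensions k N Z Y B F S f =
     (SIGMA l:p_params N B S. alg_extensions_at k N Z Y B F S f l)"

text \<open>All classes obtained by pushing the classes collected in \<open>EE\<close> forward along \<open>Y\<close>.\<close>

definition forward_closure ::
    "nat \<Rightarrow> int \<Rightarrow> 'v::linorder filtration \<Rightarrow> int set \<Rightarrow> (int \<times> ('v, 'f::field) hclass) set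
      \<Rightarrow> (int \<times> ('v, 'f) hclass) set" where
  "forward_closure k N Y p EE = {(l', y). l' \<in> {1..N} \<and> y \<in> carrier (homology k (Y l')) \<and>
     (\<exists>l\<in>p. l \<le> l' \<and> (\<exists>y\<^sub>l. (l, y\<^sub>l) \<in> EE \<and> y = incl_map k (Y l') y\<^sub>l))}"


section \<open>Homology is a vector space, and persistent homology a persistence module\<close>

text \<open>
  The empty complex is admitted because intersections of complexes may be empty; its
  homology in degrees \<open>k \<ge> 0\<close> vanishes.
\<close>

lemma lookup_chain_smult [simp]: "Poly_Mapping.lookup (chain_smult a c) s = a * Poly_Mapping.lookup c s"
  by (simp add: chain_smult_def Poly_Mapping.map.rep_eq when_def)

lemma chain_smult_simps:
  "chain_smult a (x + y) = chain_smult a x + chain_smult a y"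
  "chain_smult (a + b) x = chain_smult a x + chain_smult b x"
  "chain_smult (a * b) x = chain_smult a (chain_smult b x)"
  "chain_smult 1 x = x" "chain_smult a 0 = 0" "chain_smult 0 x = 0"
  by (auto intro!: poly_mapping_eqI simp: lookup_add algebra_simps)

lemma chain_smult_single [simp]: "chain_smult a (Poly_Mapping.single s x) = Poly_Mapping.single s (a * x)"
  by (intro poly_mapping_eqI) (simp add: lookup_single when_def)

lemma chain_smult_sum: "chain_smult a (sum g A) = (\<Sum>x\<in>A. chain_smult a (g x))"
  by (induction A rule: infinite_finite_induct) (auto simp: chain_smult_simps)

lemma boundary_superset:
  assumes "finite A" "Poly_Mapping.keys c \<subseteq> A"
  shows "boundary c = (\<Sum>\<sigma>\<in>A. \<Sum>v\<in>\<sigma>.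
     Poly_Mapping.single (\<sigma> - {v}) ((-1) ^ card {u \<in> \<sigma>. u < v} * Poly_Mapping.lookup c \<sigma>))"
  unfolding boundary_def using assms
  by (intro sum.mono_neutral_left) (auto simp: in_keys_iff)

lemma boundary_add: "boundary (x + y) = boundary x + boundary y"
proof -
  let ?A = "Poly_Mapping.keys x \<union> Poly_Mapping.keys y"
  have "finite ?A" "Poly_Mapping.keys (x + y) \<subseteq> ?A" by (auto simp: Poly_Mapping.keys_add)
  from boundary_superset[OF this] boundary_superset[of ?A x] boundary_superset[of ?A y] show ?thesis
    by (simp add: lookup_add distrib_left single_add sum.distrib)
qed

lemma boundary_smult: "boundary (chain_smult a x) = chain_smult a (boundary x)"
proof -
  have "Poly_Mapping.keys (chain_smult a x) \<subseteq> Poly_Mapping.keys x" by (auto simp: in_keys_iff)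
  from boundary_superset[OF _ this] show ?thesis
    by (simp add: boundary_def chain_smult_sum algebra_simps)
qed

lemma boundary_0 [simp]: "boundary 0 = 0" by (simp add: boundary_def)
lemma boundary_sum: "boundary (sum g A) = (\<Sum>x\<in>A. boundary (g x))"
  by (induction A rule: infinite_finite_induct) (auto simp: boundary_add)

lemma boundary_single: "boundary (Poly_Mapping.single \<sigma> a) =
   (\<Sum>v\<in>\<sigma>. Poly_Mapping.single (\<sigma> - {v}) ((-1) ^ card {u \<in> \<sigma>. u < v} * a))"
  using boundary_superset[of "{\<sigma>}" "Poly_Mapping.single \<sigma> a"] by simp

lemma boundary_boundary_single:
  assumes "finite \<sigma>"
  shows "boundary (boundary (Poly_Mapping.single \<sigma> (a::'f::field))) = 0"
proof -
  let ?s = "\<lambda>\<sigma> v. (-1::'f) ^ card {u \<in> \<sigma>. u < v}"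
  define t where "t = (\<lambda>v u. Poly_Mapping.single (\<sigma> - {v} - {u}) (?s (\<sigma> - {v}) u * (?s \<sigma> v * a)))"
  have eq: "boundary (boundary (Poly_Mapping.single \<sigma> a)) = (\<Sum>v\<in>\<sigma>. \<Sum>u\<in>\<sigma> - {v}. t v u)"
    by (simp add: boundary_single boundary_sum t_def)
  also have "\<dots> = (\<Sum>v\<in>\<sigma>. (\<Sum>u\<in>{u\<in>\<sigma>. u < v}. t v u) + (\<Sum>u\<in>{u\<in>\<sigma>. v < u}. t v u))"
  proof (intro sum.cong refl)
    fix v
    have "\<sigma> - {v} = {u\<in>\<sigma>. u < v} \<union> {u\<in>\<sigma>. v < u}" if "v \<in> \<sigma>" using that by auto
    moreover assume "v \<in> \<sigma>"
    moreover have "(\<Sum>u\<in>{u\<in>\<sigma>. u < v} \<union> {u\<in>\<sigma>. v < u}. t v u) = (\<Sum>u\<in>{u\<in>\<sigma>. u < v}. t v u) + (\<Sum>u\<in>{u\<in>\<sigma>. v < u}. t v u)"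
      by (rule sum.union_disjoint) (use assms in auto)
    ultimately show "(\<Sum>u\<in>\<sigma> - {v}. t v u) = (\<Sum>u\<in>{u\<in>\<sigma>. u < v}. t v u) + (\<Sum>u\<in>{u\<in>\<sigma>. v < u}. t v u)"
      by simp
  qed
  also have "\<dots> = (\<Sum>v\<in>\<sigma>. \<Sum>u\<in>{u\<in>\<sigma>. u < v}. t v u) + (\<Sum>v\<in>\<sigma>. \<Sum>u\<in>{u\<in>\<sigma>. v < u}. t v u)"
    by (simp add: sum.distrib)
  also have "(\<Sum>v\<in>\<sigma>. \<Sum>u\<in>{u\<in>\<sigma>. v < u}. t v u) = (\<Sum>u\<in>\<sigma>. \<Sum>v\<in>{v\<in>\<sigma>. v < u}. t v u)"
    using sum.swap_restrict[OF assms assms, of "\<lambda>v u. t v u" "\<lambda>v u. v < u"] by simp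
  also have "\<dots> = (\<Sum>v\<in>\<sigma>. \<Sum>u\<in>{u\<in>\<sigma>. u < v}. - t v u)"
  proof (intro sum.cong refl)
    fix v u assume v: "v \<in> \<sigma>" and "u \<in> {u \<in> \<sigma>. u < v}"
    then have u: "u \<in> \<sigma>" "u < v" by auto
    have 1: "{w \<in> \<sigma> - {v}. w < u} = {w \<in> \<sigma>. w < u}" using u by auto
    have 2: "{w \<in> \<sigma>. w < v} = insert u {w \<in> \<sigma> - {u}. w < v}" using u by auto
    have 3: "?s \<sigma> v = - ?s (\<sigma> - {u}) v" unfolding 2 using assms by simp
    have 4: "\<sigma> - {u} - {v} = \<sigma> - {v} - {u}" by auto
    show "t u v = - t v u"
      unfolding t_def 1 3 4 by (simp add: single_uminus[symmetric] algebra_simps)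
  qed
  finally show ?thesis by (simp add: sum_negf)
qed

lemma chain_expand: "c = (\<Sum>\<sigma>\<in>Poly_Mapping.keys c. Poly_Mapping.single \<sigma> (Poly_Mapping.lookup c \<sigma>))"
  by (intro poly_mapping_eqI) (auto simp: lookup_sum lookup_single when_def in_keys_iff)

lemma boundary_boundary:
  assumes "c \<in> chain_space k K" shows "boundary (boundary c) = 0"
proof -
  have "\<And>\<sigma>. \<sigma> \<in> Poly_Mapping.keys c \<Longrightarrow> finite \<sigma>"
    using assms card.infinite by (fastforce simp: chain_space_def)
  then show ?thesis
    by (subst chain_expand) (simp add: boundary_sum boundary_boundary_single)
qed

lemma boundary_chains:
  assumes K: "simplicial_complex K \<or> K = {}" and c: "c \<in> chain_space (Suc k) K"
  shows "boundary c \<in> chain_space k K"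
proof -
  have "Poly_Mapping.keys (boundary c) \<subseteq> {\<sigma> \<in> K. card \<sigma> = Suc k}"
    unfolding boundary_def
  proof (rule order.trans[OF keys_sum], rule UN_least, rule order.trans[OF keys_sum], rule UN_least)
    fix \<sigma> v assume s: "\<sigma> \<in> Poly_Mapping.keys c" "v \<in> \<sigma>"
    then have "\<sigma> \<in> K" "card \<sigma> = Suc (Suc k)" using c by (auto simp: chain_space_def)
    moreover have "card (\<sigma> - {v}) = Suc k" using s calculation by simp
    moreover have "\<sigma> - {v} \<in> K" using calculation K unfolding simplicial_complex_def
      by (metis Diff_subset card.empty empty_iff nat.distinct(1))
    ultimately show "Poly_Mapping.keys (Poly_Mapping.single (\<sigma> - {v}) ((- 1) ^ card {u \<in> \<sigma>. u < v} * Poly_Mapping.lookup c \<sigma>)) \<subseteq> {\<sigma> \<in> K. card \<sigma> = Suc k}" by auto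
  qed
  then show ?thesis by (simp add: chain_space_def)
qed

lemma cring_field_ring: "cring (field_ring :: 'f::field ring)"
  apply (rule cringI)
    apply (rule abelian_groupI)
         apply (auto simp: field_ring_def algebra_simps)
   apply (metis add.right_inverse add.commute)
  apply (rule comm_monoidI; auto)
  done

lemma chains_closed:
  "x \<in> chain_space k K \<Longrightarrow> y \<in> chain_space k K \<Longrightarrow> x + y \<in> chain_space k K"
  "x \<in> chain_space k K \<Longrightarrow> chain_smult a x \<in> chain_space k K"
  "0 \<in> chain_space k K"
  using Poly_Mapping.keys_add[of x y] by (auto simp: chain_space_def in_keys_iff subset_iff)

lemma module_cycle_module: "module field_ring (cycle_module k K)"
proof (rule moduleI)
  show "abelian_group (cycle_module k K)"
  proof (rule abelian_groupI)
    fix x assume "x \<in> carrier (cycle_module k K)"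
    then show "\<exists>y\<in>carrier (cycle_module k K). y \<oplus>\<^bsub>cycle_module k K\<^esub> x = \<zero>\<^bsub>cycle_module k K\<^esub>"
      by (intro bexI[of _ "chain_smult (-1) x"])
         (auto simp: cycle_module_def chains_closed boundary_smult chain_smult_simps
          intro!: poly_mapping_eqI simp: lookup_add)
  qed (auto simp: cycle_module_def chains_closed boundary_add algebra_simps)
qed (auto simp: cring_field_ring[unfolded field_ring_def] cycle_module_def field_ring_def chains_closed boundary_smult chain_smult_simps)

lemma carrier_quotient_module: "carrier (quotient_module M H) = (\<lambda>x. H +>\<^bsub>M\<^esub> x) ` carrier M"
  by (auto simp: quotient_module_def A_RCOSETS_def' a_r_coset_def')

lemma quotient_class_ops:
  fixes M :: "('f::field, 'a) module"
  assumes M: "module field_ring M" and H: "submodule H field_ring M" and z: "z \<in> carrier M"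
  shows "a \<odot>\<^bsub>quotient_module M H\<^esub> (H +>\<^bsub>M\<^esub> z) = H +>\<^bsub>M\<^esub> (a \<odot>\<^bsub>M\<^esub> z)"
    and "w \<in> carrier M \<Longrightarrow>
      (H +>\<^bsub>M\<^esub> z) \<oplus>\<^bsub>quotient_module M H\<^esub> (H +>\<^bsub>M\<^esub> w) = H +>\<^bsub>M\<^esub> (z \<oplus>\<^bsub>M\<^esub> w)"
proof -
  interpret M: module field_ring M by fact
  interpret H: submodule H field_ring M by fact
  interpret A: abelian_subgroup H M
    using H.subgroup_axioms M.abelian_group_axioms by (intro abelian_subgroupI3)
     (auto simp: additive_subgroup_def)
  have sub: "H \<subseteq> carrier M" by (rule A.a_subset)
    have "H +>\<^bsub>M\<^esub> (a \<odot>\<^bsub>M\<^esub> x) = H +>\<^bsub>M\<^esub> (a \<odot>\<^bsub>M\<^esub> z)" if xx: "x \<in> H +>\<^bsub>M\<^esub> z" for x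
    proof -
      obtain h where h: "h \<in> H" "x = h \<oplus>\<^bsub>M\<^esub> z" using xx by (auto simp: a_r_coset_def')
      then have "a \<odot>\<^bsub>M\<^esub> x = a \<odot>\<^bsub>M\<^esub> h \<oplus>\<^bsub>M\<^esub> a \<odot>\<^bsub>M\<^esub> z"
        using z sub by (simp add: M.smult_r_distr field_ring_def subset_iff)
      moreover have "a \<odot>\<^bsub>M\<^esub> h \<in> H" using h H.smult_closed[of a h] by (simp add: field_ring_def)
      ultimately have "a \<odot>\<^bsub>M\<^esub> x \<in> H +>\<^bsub>M\<^esub> (a \<odot>\<^bsub>M\<^esub> z)" by (auto simp: a_r_coset_def')
      then show ?thesis using z by (metis A.a_repr_independence' M.smult_closed UNIV_I field_ring_def partial_object.select_convs(1))
    qed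
    moreover have "z \<in> H +>\<^bsub>M\<^esub> z" using z by (rule A.a_rcos_self)
    ultimately have "(\<Union>x\<in>H +>\<^bsub>M\<^esub> z. H +>\<^bsub>M\<^esub> (a \<odot>\<^bsub>M\<^esub> x)) = H +>\<^bsub>M\<^esub> (a \<odot>\<^bsub>M\<^esub> z)"
      by blast
    then show "a \<odot>\<^bsub>quotient_module M H\<^esub> (H +>\<^bsub>M\<^esub> z) = H +>\<^bsub>M\<^esub> (a \<odot>\<^bsub>M\<^esub> z)"
      by (simp add: quotient_module_def)
  show "w \<in> carrier M \<Longrightarrow>
      (H +>\<^bsub>M\<^esub> z) \<oplus>\<^bsub>quotient_module M H\<^esub> (H +>\<^bsub>M\<^esub> w) = H +>\<^bsub>M\<^esub> (z \<oplus>\<^bsub>M\<^esub> w)"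
    using z by (simp add: A.a_rcos_sum quotient_module_def)
qed

lemma module_quotient:
  fixes M :: "('f::field, 'a) module"
  assumes M: "module field_ring M" and H: "submodule H field_ring M"
  shows "module field_ring (quotient_module M H)"
proof -
  interpret M: module field_ring M by fact
  interpret H: submodule H field_ring M by fact
  interpret A: abelian_subgroup H M
    using H.subgroup_axioms M.abelian_group_axioms by (intro abelian_subgroupI3)
     (auto simp: additive_subgroup_def)
  have sub: "H \<subseteq> carrier M" by (rule A.a_subset)
  have cl: "\<And>a x. x \<in> carrier M \<Longrightarrow> a \<odot>\<^bsub>M\<^esub> x \<in> carrier M" by (simp add: field_ring_def)
  have car: "carrier (quotient_module M H) = (\<lambda>x. H +>\<^bsub>M\<^esub> x) ` carrier M"
    by (rule carrier_quotient_module)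
  note smq = quotient_class_ops(1)[OF M H] and adq = quotient_class_ops(2)[OF M H]
  have ad: "(H +>\<^bsub>M\<^esub> x) <+>\<^bsub>M\<^esub> (H +>\<^bsub>M\<^esub> y) = H +>\<^bsub>M\<^esub> (x \<oplus>\<^bsub>M\<^esub> y)" if "x \<in> carrier M" "y \<in> carrier M" for x y
    using that by (simp add: A.a_rcos_sum)
  have ab: "abelian_group (quotient_module M H)"
  proof (rule abelian_groupI)
    fix x assume "x \<in> carrier (quotient_module M H)"
    then obtain z where z: "z \<in> carrier M" "x = H +>\<^bsub>M\<^esub> z" by (auto simp: car)
    moreover have "H +>\<^bsub>M\<^esub> \<zero>\<^bsub>M\<^esub> = H" using sub by (simp add: M.a_coset_add_zero)
    ultimately have H0: "H <+>\<^bsub>M\<^esub> x = x" using ad[of "\<zero>\<^bsub>M\<^esub>" z] by simp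
    then show "\<zero>\<^bsub>quotient_module M H\<^esub> \<oplus>\<^bsub>quotient_module M H\<^esub> x = x"
      by (simp add: quotient_module_def)
    have "(H +>\<^bsub>M\<^esub> (\<ominus>\<^bsub>M\<^esub> z)) <+>\<^bsub>M\<^esub> x = H"
      using z ad[of "\<ominus>\<^bsub>M\<^esub> z" z] sub by (simp add: M.l_neg M.a_coset_add_zero)
    then have "(H +>\<^bsub>M\<^esub> (\<ominus>\<^bsub>M\<^esub> z)) \<oplus>\<^bsub>quotient_module M H\<^esub> x = \<zero>\<^bsub>quotient_module M H\<^esub>"
      by (simp add: quotient_module_def)
    moreover have "H +>\<^bsub>M\<^esub> (\<ominus>\<^bsub>M\<^esub> z) \<in> carrier (quotient_module M H)" using z by (auto simp: car)
    ultimately show "\<exists>y\<in>carrier (quotient_module M H). y \<oplus>\<^bsub>quotient_module M H\<^esub> x = \<zero>\<^bsub>quotient_module M H\<^esub>" by blast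
  next
    show "\<zero>\<^bsub>quotient_module M H\<^esub> \<in> carrier (quotient_module M H)"
      unfolding car by (rule image_eqI[of _ _ "\<zero>\<^bsub>M\<^esub>"]) (use sub in \<open>simp_all add: quotient_module_def M.a_coset_add_zero\<close>)
  qed (auto simp: car adq M.a_ac M.a_comm)
  note ax = M.smult_l_distr M.smult_r_distr M.smult_assoc1 M.smult_one
  show ?thesis
    by (rule moduleI, rule cring_field_ring, rule ab)
      (use ax in \<open>clarsimp simp: car smq cl adq field_ring_def; fail\<close>)+
qed

lemma submodule_boundaries:
  fixes K :: "'v::linorder set set"
  assumes "simplicial_complex K \<or> K = {}"
  shows "submodule (boundaries k K :: ('v set \<Rightarrow>\<^sub>0 'f::field) set) field_ring (cycle_module k K)"
    (is "submodule ?B _ _")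
proof -
  interpret module field_ring "cycle_module k K :: ('f, _) module" by (rule module_cycle_module)
  have *: "?B \<subseteq> carrier (cycle_module k K)"
    using assms by (auto simp: boundaries_def cycle_module_def boundary_chains boundary_boundary)
  have sm: "chain_smult a x \<in> ?B" if "x \<in> ?B" for a :: 'f and x
    using that by (auto simp: boundaries_def boundary_smult[symmetric] chains_closed)
  have ad: "x + y \<in> ?B" if "x \<in> ?B" "y \<in> ?B" for x y
    using that by (auto simp: boundaries_def boundary_add[symmetric] chains_closed)
  have z: "0 \<in> ?B" 
    unfolding boundaries_def by (metis boundary_0 chains_closed(3) image_eqI)
  show ?thesis
  proof (rule submoduleI)
    fix a assume a: "a \<in> ?B"
    have "\<ominus>\<^bsub>cycle_module k K\<^esub> a = chain_smult (-1) a"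
    proof (rule minus_equality)
      have "chain_smult (- 1) a + a = 0" by (intro poly_mapping_eqI) (simp add: lookup_add)
      then show "chain_smult (- 1) a \<oplus>\<^bsub>cycle_module k K\<^esub> a = \<zero>\<^bsub>cycle_module k K\<^esub>"
        by (simp add: cycle_module_def)
    qed (use a * sm in auto)
    then show "\<ominus>\<^bsub>cycle_module k K\<^esub> a \<in> ?B" using a sm by simp
  qed (use * sm ad z in \<open>auto simp: cycle_module_def\<close>)
qed

lemma module_homology:
  "simplicial_complex K \<or> K = {} \<Longrightarrow> module field_ring (homology k K)"
  unfolding homology_def by (intro module_quotient module_cycle_module submodule_boundaries)

lemma cycle_module_ops:
  "x \<oplus>\<^bsub>cycle_module k K\<^esub> y = x + y" "a \<odot>\<^bsub>cycle_module k K\<^esub> x = chain_smult a x"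
  by (simp_all add: cycle_module_def)

lemma carrier_homology:
  "carrier (homology k K) =
     (\<lambda>z. boundaries k K +>\<^bsub>cycle_module k K\<^esub> z) ` carrier (cycle_module k K)"
  unfolding homology_def by (rule carrier_quotient_module)

lemma homology_class_ops:
  fixes K :: "'v::linorder set set" and z w :: "'v set \<Rightarrow>\<^sub>0 'f::field"
  assumes K: "simplicial_complex K \<or> K = {}" and z: "z \<in> carrier (cycle_module k K)"
  shows "a \<odot>\<^bsub>homology k K\<^esub> (boundaries k K +>\<^bsub>cycle_module k K\<^esub> z)
      = boundaries k K +>\<^bsub>cycle_module k K\<^esub> chain_smult a z"
    and "w \<in> carrier (cycle_module k K) \<Longrightarrow>
      (boundaries k K +>\<^bsub>cycle_module k K\<^esub> z) \<oplus>\<^bsub>homology k K\<^esub> (boundaries k K +>\<^bsub>cycle_module k K\<^esub> w)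
      = boundaries k K +>\<^bsub>cycle_module k K\<^esub> (z + w)"
  using quotient_class_ops[OF module_cycle_module submodule_boundaries[OF K] z]
  unfolding homology_def cycle_module_ops by blast+

lemma incl_map_class:
  fixes K L :: "'v::linorder set set" and z :: "'v set \<Rightarrow>\<^sub>0 'f::field"
  assumes KL: "K \<subseteq> L" and L: "simplicial_complex L \<or> L = {}" and z: "z \<in> carrier (cycle_module k K)"
  shows "z \<in> carrier (cycle_module k L)"
    and "incl_map k L (boundaries k K +>\<^bsub>cycle_module k K\<^esub> z) = boundaries k L +>\<^bsub>cycle_module k L\<^esub> z"
proof -
  interpret submodule "boundaries k L :: ('v set \<Rightarrow>\<^sub>0 'f) set" field_ring "cycle_module k L"
    using L by (rule submodule_boundaries)
  have B: "boundaries k K \<subseteq> (boundaries k L :: ('v set \<Rightarrow>\<^sub>0 'f) set)"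
    using KL by (auto simp: boundaries_def chain_space_def)
  show zL: "z \<in> carrier (cycle_module k L)"
    using z KL by (auto simp: cycle_module_def chain_space_def)
  have add: "x + y \<in> boundaries k L" if "x \<in> boundaries k L" "y \<in> boundaries k L" for x y :: "'v set \<Rightarrow>\<^sub>0 'f"
    using m_closed[of x y] that by (simp add: cycle_module_def)
  have zero: "0 \<in> (boundaries k K :: ('v set \<Rightarrow>\<^sub>0 'f) set)"
    unfolding boundaries_def by (metis boundary_0 chains_closed(3) image_eqI)
  show "incl_map k L (boundaries k K +>\<^bsub>cycle_module k K\<^esub> z) = boundaries k L +>\<^bsub>cycle_module k L\<^esub> z"
    unfolding incl_map_def a_r_coset_def'
    cycle_module_ops
  proof (intro subset_antisym subsetI)
    fix x assume "x \<in> (\<Union>y\<in>\<Union>h\<in>boundaries k K. {h + z}. \<Union>h\<in>boundaries k L. {h + y})"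
    then obtain b c where "b \<in> boundaries k K" "c \<in> boundaries k L" "x = c + (b + z)"
      by blast
    then have "c + b \<in> boundaries k L" "x = (c + b) + z" using B add[of c b] by (auto simp: add.assoc)
    then show "x \<in> (\<Union>h\<in>boundaries k L. {h + z})" by blast
  next
    fix x assume "x \<in> (\<Union>h\<in>boundaries k L. {h + z})"
    then obtain c where "c \<in> boundaries k L" "x = c + (0 + z)" by auto
    then show "x \<in> (\<Union>y\<in>\<Union>h\<in>boundaries k K. {h + z}. \<Union>h\<in>boundaries k L. {h + y})"
      using zero by blast
  qed
qed

lemma incl_map_linear:
  fixes K L :: "'v::linorder set set"
  assumes KL: "K \<subseteq> L" and K: "simplicial_complex K \<or> K = {}" and L: "simplicial_complex L \<or> L = {}"
  shows "incl_map k L \<in> linear_maps (homology k K) (homology k L :: ('f::field, ('v, 'f) hclass) module)"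
proof -
  let ?C = "\<lambda>K. carrier (cycle_module k K) :: ('v set \<Rightarrow>\<^sub>0 'f) set"
  have c: "x + y \<in> ?C K" "chain_smult a x \<in> ?C K" if "x \<in> ?C K" "y \<in> ?C K" for x y a
    using that by (auto simp: cycle_module_def chains_closed boundary_add boundary_smult chain_smult_simps)
  show ?thesis
    unfolding linear_maps_def carrier_homology
  proof (intro CollectI conjI funcsetI ballI allI; elim imageE; hypsubst)
  qed (simp_all add: c homology_class_ops[OF K] homology_class_ops[OF L] incl_map_class[OF KL L])
qed

lemma module_zero_module: "module field_ring (zero_module z :: ('f::field, 'a) module)"
  by (rule moduleI, rule cring_field_ring, rule abelian_groupI) (auto simp: zero_module_def)

theorem persistence_module_persistent_homology:
  assumes "\<And>l. l \<in> {1..N} \<Longrightarrow> simplicial_complex (X l) \<or> X l = {}"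
    and "\<And>l. l \<in> {1..<N} \<Longrightarrow> X l \<subseteq> X (l + 1)"
  shows "persistence_module (persistent_homology k N X :: ('f::field, ('v::linorder, 'f) hclass) pmodule)"
proof -
  define D where "D = (\<lambda>l. if l \<in> {1..N} then homology k (X l) else zero_module {0} :: ('f, ('v, 'f) hclass) module)"
  have D: "module field_ring (D l)" for l
    using assms(1) by (auto simp: D_def module_homology module_zero_module)
  have "(\<lambda>x. \<zero>\<^bsub>D l'\<^esub>) \<in> linear_maps (D l) (D l')" for l l'
  proof -
    interpret module field_ring "D l'" by (rule D)
    show ?thesis using smult_r_null by (auto simp: linear_maps_def field_ring_def)
  qed
  moreover have "incl_map k (X (l + 1)) \<in> linear_maps (D l) (D (l + 1))" if "l \<in> {1..<N}" for l
    using that assms(1)[of l] assms(1)[of "l + 1"] assms(2)[of l]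
    by (auto simp: D_def intro!: incl_map_linear)
  moreover have "str (persistent_homology k N X) l =
      (if l \<in> {1..<N} then incl_map k (X (l + 1)) else (\<lambda>x. \<zero>\<^bsub>D (l + 1)\<^esub>))" for l
    by (auto simp: persistent_homology_def D_def fun_eq_iff)
  ultimately have "str (persistent_homology k N X) l \<in> linear_maps (D l) (D (l + 1))" for l
    by presburger
  moreover have "deg (persistent_homology k N X) = D" by (simp add: persistent_homology_def D_def)
  ultimately show ?thesis using D by (simp add: persistence_module_def)
qed

end

theory Submission
  imports Defs
begin

text \<open>
  Write \<open>X l\<close> for the auxiliary complex \<open>Z \<psi> \<inter> Y l\<close>. Since \<open>Y N\<close> is the complete simplex,
  \<open>X N = Z \<psi>\<close>, so a restriction of \<open>\<tau>\<close> at \<open>l\<close> is a class of \<open>X l\<close> that the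
  inclusion into the last level of the auxiliary filtration sends to \<open>\<tau>\<close>. The problem has
  thereby moved into one persistence module, where the interval decomposition turns it into
  linear algebra on coordinates indexed by the bars: a class of level \<open>l\<close> is a combination
  of the bars alive at \<open>l\<close> (\<open>carrier_level\<close>), and an inclusion keeps the coordinates of the
  bars that survive and forgets the others (\<open>incl_map_comb\<close>).

  Read in coordinates, a class of level \<open>l\<close> restricts \<open>\<tau>\<close> iff its coordinates on the bars of
  infinite death are those of \<open>\<tau>\<close>, while its coordinates on the bars that die later than \<open>l\<close>
  but in finite time are arbitrary. As the coordinates of \<open>\<tau>\<close> on \<open>S\<close> are nonzero, this
  needs every bar of \<open>S\<close> to be born by then, so there are no restrictions before \<open>ell0\<close>
  (\<open>ell0_le_of_restriction\<close>). From \<open>ell0\<close> on, the restrictions are exactly the affine space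
  that the algorithm computes (\<open>level_restrictions_eq\<close>, \<open>alg_restrictions_eq\<close>).

  It remains to see that the levels in \<open>p_params\<close> are enough. New freedom in the choice of a
  restriction appears only when a bar of finite death is born after \<open>ell0\<close>, and these births
  are in \<open>p_params\<close>. So the bars occurring in a restriction at \<open>l'\<close> are all alive already at the
  largest \<open>l \<in> p_params\<close> with \<open>l \<le> l'\<close>, and the same coordinates define a
  restriction at \<open>l\<close> that is sent to the given one (\<open>restriction_from_p_params\<close>). Conversely
  restrictions are pushed forward to restrictions (\<open>restriction_transport\<close>). Both facts pass
  from the auxiliary filtration to \<open>Y\<close> because the inclusions of \<open>X l\<close> into \<open>X l'\<close>,
  \<open>Y l\<close> and \<open>Y l'\<close> commute.
\<close>


section \<open>Functoriality of inclusions\<close>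

lemma incl_map_closed:
  fixes K L :: "'v::linorder set set" and x :: "('v, 'f::field) hclass"
  assumes "K \<subseteq> L" and "simplicial_complex K \<or> K = {}" and "simplicial_complex L \<or> L = {}"
    and "x \<in> carrier (homology k K)"
  shows "incl_map k L x \<in> carrier (homology k L)"
  using incl_map_linear[OF assms(1-3), where 'f = 'f, of k] assms(4) by (auto simp: linear_maps_def)

lemma incl_map_incl_map:
  fixes K L M :: "'v::linorder set set" and x :: "('v, 'f::field) hclass"
  assumes KL: "K \<subseteq> L" and LM: "L \<subseteq> M"
    and L: "simplicial_complex L \<or> L = {}" and M: "simplicial_complex M \<or> M = {}"
    and x: "x \<in> carrier (homology k K)"
  shows "incl_map k M (incl_map k L x) = incl_map k M x"
proof -
  obtain z where z: "z \<in> carrier (cycle_module k K)"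
    and xz: "x = boundaries k K +>\<^bsub>cycle_module k K\<^esub> z"
    using x by (auto simp: carrier_homology)
  show ?thesis
    unfolding xz incl_map_class(2)[OF KL L z]
      incl_map_class(2)[OF LM M incl_map_class(1)[OF KL L z]]
    using KL LM M z by (auto simp: incl_map_class(2)[of K M])
qed

lemma incl_map_self:
  fixes K :: "'v::linorder set set" and x :: "('v, 'f::field) hclass"
  assumes "simplicial_complex K \<or> K = {}" and "x \<in> carrier (homology k K)"
  shows "incl_map k K x = x"
  using assms incl_map_class(2)[of K K _ k] by (auto simp: carrier_homology)


section \<open>Coordinates given by an interval decomposition\<close>

text \<open>
  The class whose coordinates are \<open>c\<close> on the bars in \<open>T\<close> and \<open>0\<close> elsewhere; meaningful when all
  bars in \<open>T\<close> are alive at \<open>l\<close>. Keeping the support \<open>T\<close> apart from the coefficients makes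
  inclusions act by shrinking \<open>T\<close> alone, with \<open>c\<close> unchanged.
\<close>

definition bar_combination ::
    "'b barcode \<Rightarrow> (int \<Rightarrow> ('b \<Rightarrow> 'f::field) \<Rightarrow> ('v, 'f) hclass) \<Rightarrow> int \<Rightarrow> 'b set \<Rightarrow> ('b \<Rightarrow> 'f)
      \<Rightarrow> ('v, 'f) hclass" where
  "bar_combination B F l T c = F l (\<lambda>\<rho>\<in>bars B. if \<rho> \<in> T then c \<rho> else 0)"

lemma bar_combination_cong:
  "T \<inter> bars B = T' \<inter> bars B \<Longrightarrow> (\<And>\<rho>. \<rho> \<in> T \<Longrightarrow> \<rho> \<in> T' \<Longrightarrow> c \<rho> = d \<rho>)
    \<Longrightarrow> bar_combination B F l T c = bar_combination B F l T' d"
  unfolding bar_combination_def by (intro arg_cong[of _ _ "F l"] restrict_ext) auto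

lemma bar_class_conv_combination: "bar_class B F l \<rho> = bar_combination B F l {\<rho>} (\<lambda>_. 1)"
  by (simp add: bar_class_def bar_combination_def)

text \<open>
  Levels may be empty, as intersections of complexes can be; the auxiliary filtration is an
  instance of this locale but not in general a filtered complex.
\<close>

locale decomposed_filtration =
  fixes k :: nat and N :: int and X :: "'v::linorder filtration" and B :: "'b barcode"
    and F :: "int \<Rightarrow> ('b \<Rightarrow> 'f::field) \<Rightarrow> ('v, 'f) hclass"
  assumes cplx: "l \<in> {1..N} \<Longrightarrow> simplicial_complex (X l) \<or> X l = {}"
    and nested: "l \<in> {1..<N} \<Longrightarrow> X l \<subseteq> X (l + 1)"
    and decomp: "interval_decomposition k N X B F"
begin

abbreviation comb where "comb \<equiv> bar_combination B F"

abbreviation bar_sum where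
  "bar_sum \<equiv> pmodule_sum (bars B) (\<lambda>\<rho>. interval_pmodule (birth B \<rho>) (death B \<rho>)) :: ('f, 'b \<Rightarrow> 'f) pmodule"

abbreviation coords where "coords T c \<equiv> (\<lambda>\<rho>\<in>bars B. if \<rho> \<in> T then c \<rho> else 0)"

lemma mono: "l \<in> {1..N} \<Longrightarrow> l' \<in> {1..N} \<Longrightarrow> l \<le> l' \<Longrightarrow> X l \<subseteq> X l'"
proof (rotate_tac 2, induction l' rule: int_ge_induct)
  case (step i)
  then show ?case using nested[of i] by auto
qed simp

lemma finite_bars: "finite (bars B)" and birth_less_death: "\<rho> \<in> bars B \<Longrightarrow> birth B \<rho> < death B \<rho>"
  using decomp by (auto simp: interval_decomposition_def)

lemma finite_alive: "T \<subseteq> alive_bars B l \<Longrightarrow> finite T"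
  by (rule finite_subset[OF _ finite_bars]) (auto simp: alive_bars_def)

lemma F_morphism:
  shows F_bij: "bij_betw (F l) (carrier (deg bar_sum l)) (carrier (deg (persistent_homology k N X) l))"
    and F_linear: "F l \<in> linear_maps (deg bar_sum l) (deg (persistent_homology k N X) l)"
    and F_str: "x \<in> carrier (deg bar_sum l)
      \<Longrightarrow> F (l + 1) (str bar_sum l x) = str (persistent_homology k N X) l (F l x)"
  using decomp by (auto simp: interval_decomposition_def pmodule_iso_def pmodule_morphism_def)

lemma coords_carrier: "T \<subseteq> alive_bars B l \<Longrightarrow> coords T c \<in> carrier (deg bar_sum l)"
  by (auto simp: pmodule_sum_def interval_pmodule_def zero_module_def alive_bars_def)

text \<open>
  Interval modules vanish outside their interval, so only the bars alive at \<open>l\<close> carry free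
  coordinates.
\<close>

lemma carrier_bar_sum: "carrier (deg bar_sum l) = range (coords (alive_bars B l))"
proof (intro subset_antisym subsetI)
  fix x assume x: "x \<in> carrier (deg bar_sum l)"
  have "coords (alive_bars B l) x = x"
  proof
    fix \<rho>
    have "x \<in> extensional (bars B)" using x by (simp add: pmodule_sum_def PiE_def)
    moreover have "x \<rho> = 0" if "\<rho> \<in> bars B" "\<rho> \<notin> alive_bars B l"
    proof -
      have "x \<rho> \<in> carrier (deg (interval_pmodule (birth B \<rho>) (death B \<rho>)) l)"
        using x that by (auto simp: pmodule_sum_def)
      then show ?thesis using that
        by (auto simp: interval_pmodule_def zero_module_def alive_bars_def split: if_splits)
    qed
    ultimately show "coords (alive_bars B l) x \<rho> = x \<rho>" by (auto simp: extensional_def)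
  qed
  with rangeI[of "coords (alive_bars B l)" x] show "x \<in> range (coords (alive_bars B l))"
    by (simp only:)
qed (use coords_carrier in blast)

lemma deg_persistent_homology:
  "l \<in> {1..N} \<Longrightarrow> deg (persistent_homology k N X) l = homology k (X l)"
  by (simp add: persistent_homology_def)

lemma module_level: "l \<in> {1..N} \<Longrightarrow> module field_ring (homology k (X l) :: ('f, ('v, 'f) hclass) module)"
  using cplx by (intro module_homology)

lemma carrier_level:
  assumes "l \<in> {1..N}"
  shows "carrier (homology k (X l)) = range (comb l (alive_bars B l))"
  using F_bij[of l] assms
  by (simp add: bij_betw_def carrier_bar_sum deg_persistent_homology bar_combination_def image_image)

lemma comb_closed:
  assumes "l \<in> {1..N}" "T \<subseteq> alive_bars B l"
  shows "comb l T c \<in> carrier (homology k (X l))"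
  using bij_betw_apply[OF F_bij coords_carrier[OF assms(2)]] assms(1)
  by (simp add: bar_combination_def deg_persistent_homology)

text \<open>
  Uniqueness of coordinates: the decomposition is injective in each degree.
\<close>

lemma comb_eqD:
  assumes eq: "comb l T c = comb l U d" and T: "T \<subseteq> alive_bars B l" and U: "U \<subseteq> alive_bars B l"
    and \<rho>: "\<rho> \<in> alive_bars B l"
  shows "(if \<rho> \<in> T then c \<rho> else 0) = (if \<rho> \<in> U then d \<rho> else 0)"
proof -
  have "coords T c = coords U d"
    by (rule inj_onD[where f = "F l", OF bij_betw_imp_inj_on[OF F_bij] eq[unfolded bar_combination_def]])
      (rule coords_carrier[OF T], rule coords_carrier[OF U])
  then have "coords T c \<rho> = coords U d \<rho>" by (rule fun_cong)
  then show ?thesis using \<rho> by (simp add: alive_bars_def)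
qed

text \<open>
  A bar is alive at its birth and so contributes a nonzero class there, whereas the
  persistence module vanishes outside \<open>1..N\<close>.
\<close>

lemma birth_bounds:
  assumes "\<rho> \<in> bars B"
  shows "birth B \<rho> \<in> {1..N}"
proof (rule ccontr)
  let ?l = "birth B \<rho>"
  assume "?l \<notin> {1..N}"
  then have *: "carrier (deg (persistent_homology k N X) ?l) = {{0}}"
    by (auto simp: persistent_homology_def zero_module_def)
  have \<rho>: "\<rho> \<in> alive_bars B ?l" using assms birth_less_death by (simp add: alive_bars_def)
  have "comb ?l T c \<in> {{0}}" if "T \<subseteq> alive_bars B ?l" for T c
    using bij_betw_apply[OF F_bij coords_carrier[OF that]]
    unfolding bar_combination_def * by blast
  from this[of "{\<rho>}" "\<lambda>_. 1"] this[of "{}" "\<lambda>_. 1"] \<rho>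
  have "comb ?l {\<rho>} (\<lambda>_. 1) = comb ?l {} (\<lambda>_. 1)" by simp
  from comb_eqD[OF this _ _ \<rho>] \<rho> show False by simp
qed

lemma comb_smult:
  assumes "l \<in> {1..N}" "T \<subseteq> alive_bars B l"
  shows "a \<odot>\<^bsub>homology k (X l)\<^esub> comb l T c = comb l T (\<lambda>\<rho>. a * c \<rho>)"
proof -
  have "a \<odot>\<^bsub>deg bar_sum l\<^esub> coords T c = coords T (\<lambda>\<rho>. a * c \<rho>)"
    using assms(2)
    by (auto simp: pmodule_sum_def interval_pmodule_def zero_module_def alive_bars_def fun_eq_iff)
  then show ?thesis
    using F_linear[of l] coords_carrier[OF assms(2), of c] assms(1)
    unfolding bar_combination_def linear_maps_def deg_persistent_homology[OF assms(1)]
    by (smt (verit) mem_Collect_eq)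
qed

lemma comb_union:
  assumes l: "l \<in> {1..N}" and T: "T \<subseteq> alive_bars B l" and U: "U \<subseteq> alive_bars B l"
    and disj: "T \<inter> U = {}"
  shows "comb l T c \<oplus>\<^bsub>homology k (X l)\<^esub> comb l U c = comb l (T \<union> U) c"
proof -
  have "coords T c \<oplus>\<^bsub>deg bar_sum l\<^esub> coords U c = coords (T \<union> U) c"
    using T U disj
    by (auto simp: pmodule_sum_def interval_pmodule_def zero_module_def alive_bars_def fun_eq_iff)
  then show ?thesis
    using F_linear[of l] coords_carrier[OF T, of c] coords_carrier[OF U, of c]
    unfolding bar_combination_def linear_maps_def deg_persistent_homology[OF l]
    by (smt (verit) mem_Collect_eq)
qed

lemma comb_empty:
  assumes "l \<in> {1..N}"
  shows "comb l {} c = \<zero>\<^bsub>homology k (X l)\<^esub>"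
proof -
  interpret module field_ring "homology k (X l) :: ('f, _) module" by (rule module_level[OF assms])
  have "comb l {} c = 0 \<odot>\<^bsub>homology k (X l)\<^esub> comb l {} c"
    using comb_smult[OF assms, of "{}" 0 c] by (simp add: bar_combination_def)
  also have "\<dots> = \<zero>\<^bsub>homology k (X l)\<^esub>"
    using smult_l_null[OF comb_closed[OF assms, of "{}" c]] by (simp add: field_ring_def)
  finally show ?thesis .
qed

lemma finsum_bar_class:
  assumes l: "l \<in> {1..N}" and T: "T \<subseteq> alive_bars B l"
  shows "(\<Oplus>\<^bsub>homology k (X l)\<^esub>\<rho>\<in>T. c \<rho> \<odot>\<^bsub>homology k (X l)\<^esub> bar_class B F l \<rho>) = comb l T c"
proof -
  let ?H = "homology k (X l) :: ('f, _) module"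
  interpret module field_ring ?H by (rule module_level[OF l])
  have summand: "c \<rho> \<odot>\<^bsub>?H\<^esub> bar_class B F l \<rho> = comb l {\<rho>} c" if "\<rho> \<in> alive_bars B l" for \<rho>
  proof -
    have "c \<rho> \<odot>\<^bsub>?H\<^esub> bar_class B F l \<rho> = comb l {\<rho>} (\<lambda>_. c \<rho> * 1)"
      unfolding bar_class_conv_combination by (rule comb_smult[OF l]) (use that in simp)
    also have "\<dots> = comb l {\<rho>} c" by (rule bar_combination_cong) simp_all
    finally show ?thesis .
  qed
  have "finite T" using T by (rule finite_alive)
  then show ?thesis using T
  proof (induction T)
    case empty
    then show ?case using comb_empty[OF l] by simp
  next
    case (insert \<rho> T)
    have "(\<Oplus>\<^bsub>?H\<^esub>\<rho>\<in>insert \<rho> T. c \<rho> \<odot>\<^bsub>?H\<^esub> bar_class B F l \<rho>) =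
        c \<rho> \<odot>\<^bsub>?H\<^esub> bar_class B F l \<rho> \<oplus>\<^bsub>?H\<^esub> (\<Oplus>\<^bsub>?H\<^esub>\<rho>\<in>T. c \<rho> \<odot>\<^bsub>?H\<^esub> bar_class B F l \<rho>)"
      by (rule finsum_insert) (use insert.hyps insert.prems in \<open>auto simp: summand comb_closed[OF l]\<close>)
    also have "\<dots> = comb l {\<rho>} c \<oplus>\<^bsub>?H\<^esub> comb l T c"
      using insert by (simp add: summand)
    also have "\<dots> = comb l (insert \<rho> T) c"
      using comb_union[OF l, of "{\<rho>}" T c] insert by simp
    finally show ?case .
  qed
qed

lemma inj_on_bar_class: "inj_on (bar_class B F l) (alive_bars B l)"
proof (rule inj_onI)
  fix \<rho> \<mu> assume \<rho>: "\<rho> \<in> alive_bars B l" and \<mu>: "\<mu> \<in> alive_bars B l"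
    and eq: "bar_class B F l \<rho> = bar_class B F l \<mu>"
  show "\<rho> = \<mu>"
    using comb_eqD[OF eq[unfolded bar_class_conv_combination] _ _ \<rho>] \<rho> \<mu>
    by (simp split: if_splits)
qed

text \<open>
  Elements of the span are sums over sets of classes, those of \<open>range (comb l T)\<close> sums over
  sets of bars. The two agree because distinct bars alive at \<open>l\<close> have distinct classes, so that
  coefficients can be moved from one indexing to the other.
\<close>

lemma lin_span_bar_class:
  assumes l: "l \<in> {1..N}" and T: "T \<subseteq> alive_bars B l"
  shows "lin_span (homology k (X l)) (bar_class B F l ` T) = range (comb l T)"
proof -
  let ?H = "homology k (X l) :: ('f, _) module"
  let ?b = "bar_class B F l"
  interpret module field_ring ?H by (rule module_level[OF l])
  have b: "?b \<rho> \<in> carrier ?H" if "\<rho> \<in> T" for \<rho>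
    unfolding bar_class_conv_combination using that T by (intro comb_closed[OF l]) auto
  have sum: "(\<Oplus>\<^bsub>?H\<^esub>v\<in>?b ` U. c v \<odot>\<^bsub>?H\<^esub> v) = comb l U (\<lambda>\<rho>. c (?b \<rho>))" if U: "U \<subseteq> T" for U c
  proof -
    have "(\<Oplus>\<^bsub>?H\<^esub>v\<in>?b ` U. c v \<odot>\<^bsub>?H\<^esub> v) = (\<Oplus>\<^bsub>?H\<^esub>\<rho>\<in>U. c (?b \<rho>) \<odot>\<^bsub>?H\<^esub> ?b \<rho>)"
    proof (rule finsum_reindex)
      show "inj_on ?b U" using inj_on_bar_class U T by (meson inj_on_subset subset_trans)
      have "c v \<odot>\<^bsub>?H\<^esub> v \<in> carrier ?H" if "v \<in> ?b ` U" for v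
        using smult_closed[of "c v" v] b that U by (auto simp: field_ring_def)
      then show "(\<lambda>v. c v \<odot>\<^bsub>?H\<^esub> v) \<in> ?b ` U \<rightarrow> carrier ?H" by blast
    qed
    then show ?thesis using U T by (simp add: finsum_bar_class[OF l])
  qed
  show ?thesis
  proof (intro subset_antisym subsetI)
    fix x assume "x \<in> lin_span ?H (?b ` T)"
    then obtain A c where "A \<subseteq> ?b ` T" and x: "x = (\<Oplus>\<^bsub>?H\<^esub>v\<in>A. c v \<odot>\<^bsub>?H\<^esub> v)"
      by (auto simp: lin_span_def)
    then obtain U where U: "U \<subseteq> T" "A = ?b ` U" by (auto simp: subset_image_iff)
    have "x = comb l T (\<lambda>\<rho>. if \<rho> \<in> U then c (?b \<rho>) else 0)"
      unfolding x U(2) sum[OF U(1)] bar_combination_def using U(1)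
      by (intro arg_cong[of _ _ "F l"] restrict_ext) auto
    then show "x \<in> range (comb l T)" by (simp only: rangeI)
  next
    fix x assume "x \<in> range (comb l T)"
    then obtain d where x: "x = comb l T d" by blast
    have inj: "inj_on ?b T" using inj_on_bar_class T by (rule inj_on_subset)
    have "x = comb l T (\<lambda>\<rho>. d (the_inv_into T ?b (?b \<rho>)))"
      unfolding x by (rule bar_combination_cong) (simp_all add: the_inv_into_f_f[OF inj])
    also have "\<dots> = (\<Oplus>\<^bsub>?H\<^esub>v\<in>?b ` T. d (the_inv_into T ?b v) \<odot>\<^bsub>?H\<^esub> v)"
      using sum[of T "\<lambda>v. d (the_inv_into T ?b v)"] by simp
    finally show "x \<in> lin_span ?H (?b ` T)"
      using finite_alive[OF T]
      by (auto simp: lin_span_def intro!: exI[of _ "?b ` T"] exI[of _ "\<lambda>v. d (the_inv_into T ?b v)"])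
  qed
qed

text \<open>
  An inclusion keeps the coordinates of the bars that are still alive and kills the others:
  in interval modules the structure maps are identities until the death.
\<close>

lemma incl_map_comb:
  assumes l: "1 \<le> l" "l \<le> l'" "l' \<le> N" and T: "T \<subseteq> alive_bars B l"
  shows "incl_map k (X l') (comb l T c) = comb l' (T \<inter> alive_bars B l') c"
  using l(2) l(3)
proof (induction l' rule: int_ge_induct)
  case base
  have "incl_map k (X l) (comb l T c) = comb l T c"
    using incl_map_self[OF cplx comb_closed[OF _ T]] l by auto
  then show ?case using T by (simp add: inf.absorb1)
next
  case (step i)
  let ?T = "T \<inter> alive_bars B i"
  have il: "i \<in> {1..<N}" "l \<in> {1..N}" "i \<in> {1..N}" "i + 1 \<in> {1..N}" using step l by auto
  \<comment> \<open>A bar alive at \<open>l\<close> and at \<open>i + 1\<close> is alive in between, so none is lost and regained.\<close>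
  have alive: "T \<inter> alive_bars B (i + 1) = ?T \<inter> alive_bars B (i + 1)"
    using T step.hyps by (auto simp: alive_bars_def)
  have "incl_map k (X (i + 1)) (comb l T c) = incl_map k (X (i + 1)) (incl_map k (X i) (comb l T c))"
    by (rule incl_map_incl_map[OF mono mono cplx cplx comb_closed[OF _ T], symmetric])
      (use il step.hyps in simp_all)
  also have "\<dots> = incl_map k (X (i + 1)) (comb i ?T c)" using step il by simp
  also have "\<dots> = str (persistent_homology k N X) i (F i (coords ?T c))"
    using il by (simp add: persistent_homology_def bar_combination_def)
  also have "\<dots> = F (i + 1) (str bar_sum i (coords ?T c))"
    by (rule F_str[symmetric]) (rule coords_carrier, blast)
  also have "str bar_sum i (coords ?T c) = coords (?T \<inter> alive_bars B (i + 1)) c"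
    by (auto simp: pmodule_sum_def interval_pmodule_def alive_bars_def fun_eq_iff)
  also have "F (i + 1) \<dots> = comb (i + 1) (T \<inter> alive_bars B (i + 1)) c"
    by (simp only: bar_combination_def alive)
  finally show ?case .
qed

end


section \<open>Restrictions and the output of the algorithm\<close>

locale represented_class = decomposed_filtration k N X B F
  for k N and X :: "'v::linorder filtration" and B :: "'b barcode"
    and F :: "int \<Rightarrow> ('b \<Rightarrow> 'f::field) \<Rightarrow> ('v, 'f) hclass" +
  fixes \<tau> :: "('v, 'f) hclass" and S :: "'b set" and f :: "'b \<Rightarrow> 'f"
  assumes N_pos: "1 \<le> N"
    and rep: "bar_representation k X B F N \<tau> S f"
begin

lemma S_alive: "S \<subseteq> alive_bars B N" and f_nonzero: "\<rho> \<in> S \<Longrightarrow> f \<rho> \<noteq> 0"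
  using rep by (auto simp: bar_representation_def)

lemma class_eq_comb: "\<tau> = comb N S f"
  using rep finsum_bar_class[of N S f] N_pos by (simp add: bar_representation_def)

text \<open>
  This is what \<open>ell0\<close> is for: it is the first level at which all bars of \<open>S\<close> exist. Bars of \<open>S\<close>
  are alive at \<open>N\<close>, so at earlier levels only their births matter.
\<close>

lemma ell0_le_iff:
  assumes "l \<in> {1..N}"
  shows "ell0 B S \<le> l \<longleftrightarrow> S \<subseteq> alive_bars B l"
proof -
  have "ell0 B S \<le> l \<longleftrightarrow> (\<forall>\<rho>\<in>S. birth B \<rho> \<le> l)"
    using finite_alive[OF S_alive] assms by (simp add: ell0_def)
  also have "\<dots> \<longleftrightarrow> S \<subseteq> alive_bars B l"
    using S_alive assms by (fastforce simp: alive_bars_def)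
  finally show ?thesis .
qed

lemma ell0_ge_1: "1 \<le> ell0 B S"
proof (cases "S = {}")
  case False
  then have "Max (birth B ` S) \<in> birth B ` S" using finite_alive[OF S_alive] by (intro Max_in) auto
  moreover have "1 \<le> birth B \<rho>" if "\<rho> \<in> S" for \<rho>
    using birth_bounds[of \<rho>] S_alive that by (auto simp: alive_bars_def)
  ultimately show ?thesis using False by (auto simp: ell0_def)
qed (simp add: ell0_def)

text \<open>
  The restrictions of \<open>\<tau>\<close>, once \<open>X N\<close> is known to be the complex in which \<open>\<tau>\<close> lives.
\<close>

definition level_restrictions where
  "level_restrictions l = {w \<in> carrier (homology k (X l)). incl_map k (X N) w = \<tau>}"

text \<open>
  From \<open>ell0\<close> on, every bar alive at \<open>l\<close> dies after \<open>ell0\<close>, so the short bars are those whose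
  class is killed by the inclusion into the last level.
\<close>

lemma short_bars_at_eq:
  assumes "ell0 B S \<le> l" and "l \<le> N"
  shows "short_bars_at N B S l = alive_bars B l - alive_bars B N"
  using assms by (auto simp: short_bars_at_def short_bars_def alive_bars_def)

text \<open>
  A bar not yet born at \<open>l\<close> has coordinate \<open>0\<close> in the image of every class of level \<open>l\<close>,
  but the bars of \<open>S\<close> have nonzero coordinates in \<open>\<tau>\<close>.
\<close>

lemma ell0_le_of_restriction:
  assumes l: "l \<in> {1..N}" and w: "w \<in> level_restrictions l"
  shows "ell0 B S \<le> l"
proof -
  obtain c where "w = comb l (alive_bars B l) c"
    using w carrier_level[OF l] by (auto simp: level_restrictions_def)
  then have eq: "comb N (alive_bars B l \<inter> alive_bars B N) c = comb N S f"
    using w l incl_map_comb[of l N "alive_bars B l" c]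
    by (simp add: level_restrictions_def flip: class_eq_comb)
  have "\<rho> \<in> alive_bars B l" if "\<rho> \<in> S" for \<rho>
    using comb_eqD[OF eq _ S_alive, of \<rho>] S_alive f_nonzero[OF that] that by (auto split: if_splits)
  then show ?thesis using ell0_le_iff[OF l] by blast
qed

text \<open>
  Comparing coordinates at level \<open>N\<close> fixes the coefficients of all bars of infinite death: they
  are \<open>f\<close> on \<open>S\<close> and \<open>0\<close> otherwise. The short bars die before \<open>N\<close>, and their coefficients
  are unconstrained.
\<close>

lemma level_restrictions_eq:
  assumes l: "l \<in> {1..N}" and le: "ell0 B S \<le> l"
  shows "level_restrictions l =
    {comb l (S \<union> short_bars_at N B S l) c | c. \<forall>\<rho>\<in>S. c \<rho> = f \<rho>}" (is "_ = ?R")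
proof -
  let ?A = "alive_bars B l" and ?T = "S \<union> short_bars_at N B S l"
  have S: "S \<subseteq> ?A" using le ell0_le_iff[OF l] by simp
  have short: "short_bars_at N B S l = ?A - alive_bars B N"
    using short_bars_at_eq[OF le] l by simp
  show ?thesis
  proof (intro subset_antisym subsetI)
    fix w assume w: "w \<in> level_restrictions l"
    then obtain c where wc: "w = comb l ?A c"
      using carrier_level[OF l] by (auto simp: level_restrictions_def)
    then have "comb N (?A \<inter> alive_bars B N) c = comb N S f"
      using w l incl_map_comb[of l N ?A c]
      by (simp add: level_restrictions_def flip: class_eq_comb)
    from comb_eqD[OF this _ S_alive]
    have c: "(if \<rho> \<in> ?A then c \<rho> else 0) = (if \<rho> \<in> S then f \<rho> else 0)"
      if "\<rho> \<in> alive_bars B N" for \<rho> using that by (auto split: if_splits)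
    have "c \<rho> = 0" if "\<rho> \<in> ?A - ?T" for \<rho> using c[of \<rho>] that by (auto simp: short)
    then have "w = comb l ?T c"
      unfolding wc bar_combination_def using S short
      by (intro arg_cong[of _ _ "F l"] restrict_ext) auto
    moreover have "\<forall>\<rho>\<in>S. c \<rho> = f \<rho>"
      using c S S_alive by (metis subsetD)
    ultimately show "w \<in> ?R" by blast
  next
    fix w assume "w \<in> ?R"
    then obtain c where wc: "w = comb l ?T c" and c: "\<forall>\<rho>\<in>S. c \<rho> = f \<rho>" by blast
    have T: "?T \<subseteq> ?A" using S short by blast
    have "incl_map k (X N) w = comb N (?T \<inter> alive_bars B N) c"
      unfolding wc using l by (intro incl_map_comb T) auto
    also have "\<dots> = comb N S f"
      using c S_alive by (intro bar_combination_cong) (auto simp: short)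
    finally show "w \<in> level_restrictions l"
      using comb_closed[OF l T] by (simp add: level_restrictions_def wc flip: class_eq_comb)
  qed
qed

text \<open>
  The sum over \<open>S\<close> and the span of the short bars involve disjoint sets of bars, so adding them
  amounts to prescribing the coordinates on the union independently.
\<close>

lemma alg_restrictions_eq:
  assumes l: "l \<in> {1..N}" and le: "ell0 B S \<le> l" and X: "X = aux_filtration Z Y"
  shows "alg_restrictions k N Z Y B F S f l = level_restrictions l"
proof -
  let ?H = "homology k (X l) :: ('f, _) module" and ?U = "short_bars_at N B S l"
  have S: "S \<subseteq> alive_bars B l" using le ell0_le_iff[OF l] by simp
  have U: "?U = alive_bars B l - alive_bars B N" using short_bars_at_eq[OF le] l by simp
  have disj: "S \<inter> ?U = {}" using S_alive U by blast
  have sum: "comb l S f \<oplus>\<^bsub>?H\<^esub> comb l ?U d = comb l (S \<union> ?U) (\<lambda>\<rho>. if \<rho> \<in> S then f \<rho> else d \<rho>)" for d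
  proof -
    let ?c = "\<lambda>\<rho>. if \<rho> \<in> S then f \<rho> else d \<rho>"
    have "comb l S f = comb l S ?c" "comb l ?U d = comb l ?U ?c"
      by (rule bar_combination_cong; use disj in auto)+
    then show ?thesis using comb_union[OF l S _ disj, of ?c] U by auto
  qed
  have "alg_restrictions k N Z Y B F S f l = {comb l S f \<oplus>\<^bsub>?H\<^esub> comb l ?U d | d. True}"
    using finsum_bar_class[OF l S, of f] lin_span_bar_class[OF l, of ?U] U
    unfolding alg_restrictions_def Let_def X[symmetric] by auto
  also have "\<dots> = {comb l (S \<union> ?U) c | c. \<forall>\<rho>\<in>S. c \<rho> = f \<rho>}"
  proof (intro subset_antisym subsetI)
    fix w assume "w \<in> {comb l S f \<oplus>\<^bsub>?H\<^esub> comb l ?U d | d. True}"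
    then obtain d where w: "w = comb l (S \<union> ?U) (\<lambda>\<rho>. if \<rho> \<in> S then f \<rho> else d \<rho>)"
      using sum by blast
    show "w \<in> {comb l (S \<union> ?U) c | c. \<forall>\<rho>\<in>S. c \<rho> = f \<rho>}"
      by (intro CollectI exI conjI, rule w) simp
  next
    fix w assume "w \<in> {comb l (S \<union> ?U) c | c. \<forall>\<rho>\<in>S. c \<rho> = f \<rho>}"
    then obtain c where "w = comb l (S \<union> ?U) c" "\<forall>\<rho>\<in>S. c \<rho> = f \<rho>" by blast
    then have "w = comb l (S \<union> ?U) (\<lambda>\<rho>. if \<rho> \<in> S then f \<rho> else c \<rho>)"
      by (simp only:) (rule bar_combination_cong; simp)
    then show "w \<in> {comb l S f \<oplus>\<^bsub>?H\<^esub> comb l ?U d | d. True}" using sum[of c] by blast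
  qed
  finally show ?thesis using level_restrictions_eq[OF l le] by simp
qed

lemma restriction_transport:
  assumes "l \<in> {1..N}" "l' \<in> {1..N}" "l \<le> l'" "w \<in> level_restrictions l"
  shows "incl_map k (X l') w \<in> level_restrictions l'"
proof -
  have N: "N \<in> {1..N}" using N_pos by simp
  have w: "w \<in> carrier (homology k (X l))" "incl_map k (X N) w = \<tau>"
    using assms(4) by (auto simp: level_restrictions_def)
  have "incl_map k (X N) (incl_map k (X l') w) = incl_map k (X N) w"
    by (rule incl_map_incl_map[OF mono mono cplx cplx w(1)]) (use assms(1-3) N in simp_all)
  moreover have "incl_map k (X l') w \<in> carrier (homology k (X l'))"
    by (rule incl_map_closed[OF mono cplx cplx w(1)]) (use assms(1-3) in simp_all)
  ultimately show ?thesis using w(2) by (simp add: level_restrictions_def)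
qed

lemma p_params_ge: "l \<in> p_params N B S \<Longrightarrow> ell0 B S \<le> l"
  by (auto simp: p_params_def omega_bars_def)

lemma finite_p_params: "finite (p_params N B S)"
  using finite_bars by (auto simp: p_params_def omega_bars_def)

text \<open>
  The level \<open>l\<close> is the largest parameter in \<open>p_params\<close> that does not exceed \<open>l'\<close>. A bar occurring
  in \<open>w\<close> is born by \<open>ell0\<close> or its birth is itself in \<open>p_params\<close>; in both cases it is
  born by \<open>l\<close>, and so \<open>v\<close> can be given the coordinates of \<open>w\<close>.
\<close>

lemma restriction_from_p_params:
  assumes l': "l' \<in> {1..N}" and w: "w \<in> level_restrictions l'"
  obtains l v where "l \<in> p_params N B S" "l \<le> l'" "v \<in> level_restrictions l"
    "w = incl_map k (X l') v"
proof -
  let ?Q = "{l \<in> p_params N B S. l \<le> l'}" and ?T = "S \<union> short_bars_at N B S l'"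
  define l where "l = Max ?Q"
  have le: "ell0 B S \<le> l'" by (rule ell0_le_of_restriction[OF l' w])
  have fin: "finite ?Q" and ne: "ell0 B S \<in> ?Q"
    using finite_p_params le by (auto simp: p_params_def)
  then have lQ: "l \<in> ?Q" unfolding l_def by (intro Max_in) auto
  then have el: "ell0 B S \<le> l" and ll': "l \<le> l'" using p_params_ge by auto
  have l: "l \<in> {1..N}" using el ll' ell0_ge_1 l' by auto
  have T': "?T \<subseteq> alive_bars B l'"
    using ell0_le_iff[OF l'] le short_bars_at_eq[OF le] l' by auto
  have birth: "birth B \<rho> \<le> l" if "\<rho> \<in> short_bars_at N B S l'" for \<rho>
  proof (cases "birth B \<rho> \<le> ell0 B S")
    case False
    then have "birth B \<rho> \<in> ?Q"
      using that by (auto simp: p_params_def omega_bars_def short_bars_at_def short_bars_def)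
    then show ?thesis unfolding l_def using fin by (intro Max_ge)
  qed (use el in simp)
  have T: "?T \<subseteq> alive_bars B l"
  proof -
    have "\<rho> \<in> alive_bars B l" if "\<rho> \<in> short_bars_at N B S l'" for \<rho>
      using birth[OF that] that ll' by (auto simp: short_bars_at_def short_bars_def alive_bars_def)
    then show ?thesis using el ell0_le_iff[OF l] by blast
  qed
  obtain c where wc: "w = comb l' ?T c" using w level_restrictions_eq[OF l' le] by auto
  have push: "incl_map k (X l') (comb l ?T c) = w"
    using incl_map_comb[OF _ ll' _ T, of c] l l' T' wc by (simp add: inf.absorb1)
  have "incl_map k (X N) (comb l ?T c) = incl_map k (X N) (incl_map k (X l') (comb l ?T c))"
    by (rule incl_map_incl_map[OF mono mono cplx cplx comb_closed[OF l T], symmetric])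
      (use l l' ll' N_pos in simp_all)
  also have "\<dots> = \<tau>" using push w by (simp add: level_restrictions_def)
  finally have "comb l ?T c \<in> level_restrictions l"
    using comb_closed[OF l T] by (simp add: level_restrictions_def)
  then show ?thesis using that lQ push by blast
qed

end


section \<open>The algorithm recovers all cycle extensions\<close>

theorem theorem4p4:
  fixes k :: nat and P :: "'v::linorder set" and M N \<psi> :: int
    and Z Y :: "'v filtration"
    and \<tau> :: "('v, 'f::{field, finite}) hclass"
    and B :: "'b barcode"
    and \<F> :: "int \<Rightarrow> ('b \<Rightarrow> 'f) \<Rightarrow> ('v, 'f) hclass"
    and S :: "'b set" and f :: "'b \<Rightarrow> 'f"
  assumes "finite P"
    and "filtered_complex P M Z"
    and "filtered_complex P N Y"
    and "Y N = complete_simplex P"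
    and "\<psi> \<in> {1..M}"
    and "\<tau> \<in> carrier (homology k (Z \<psi>))"
    and "inj_on (\<lambda>\<rho>. (birth B \<rho>, death B \<rho>)) (bars B)"
    and "interval_decomposition k N (aux_filtration (Z \<psi>) Y) B \<F>"
    and "bar_representation k (aux_filtration (Z \<psi>) Y) B \<F> N \<tau> S f"
  shows "cycle_extensions k N (Z \<psi>) Y \<tau> =
    forward_closure k N Y (p_params N B S) (alg_extensions k N (Z \<psi>) Y B \<F> S f)"
proof -
  let ?X = "aux_filtration (Z \<psi>) Y"
  have Z: "simplicial_complex (Z \<psi>)" "\<Union> (Z \<psi>) \<subseteq> P"
    using assms(2,5) by (auto simp: filtered_complex_def)
  have Y: "simplicial_complex (Y l)" if "l \<in> {1..N}" for l
    using assms(3) that by (auto simp: filtered_complex_def)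
  have N: "1 \<le> N" using assms(3) by (simp add: filtered_complex_def)
  have cplx: "simplicial_complex (?X l) \<or> ?X l = {}" if "l \<in> {1..N}" for l
    using Z(1) Y[OF that] unfolding simplicial_complex_def aux_filtration_def
    by (metis Int_iff finite_Int)
  have "Z \<psi> \<subseteq> complete_simplex P"
    using Z by (auto simp: simplicial_complex_def complete_simplex_def)
  then have XN: "?X N = Z \<psi>" using assms(4) by (auto simp: aux_filtration_def)
  interpret represented_class k N ?X B \<F> \<tau> S f
  proof
    show "?X l \<subseteq> ?X (l + 1)" if "l \<in> {1..<N}" for l
      using assms(3) that by (auto simp: filtered_complex_def aux_filtration_def)
  qed (use cplx assms(8,9) N in auto)
  have restr: "restrictions k (Z \<psi>) Y \<tau> l = level_restrictions l" for l
    by (simp add: restrictions_def level_restrictions_def XN) (simp add: aux_filtration_def)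
  have XY: "?X l \<subseteq> Y l" for l by (simp add: aux_filtration_def)
  have Ymono: "Y l \<subseteq> Y l'" if "1 \<le> l" "l \<le> l'" "l' \<le> N" for l l'
    using that(2,3)
  proof (induction l' rule: int_ge_induct)
    case (step i)
    then have "Y i \<subseteq> Y (i + 1)" using assms(3) that(1) by (simp add: filtered_complex_def)
    then show ?case using step by auto
  qed simp
  \<comment> \<open>Extending at \<open>l\<close> and moving on in \<open>Y\<close> is the same as moving on in the auxiliary filtration and extending at \<open>l'\<close>.\<close>
  have square: "incl_map k (Y l') (incl_map k (Y l) w) = incl_map k (Y l') (incl_map k (?X l') w)"
    if l: "1 \<le> l" "l \<le> l'" "l' \<le> N" and w: "w \<in> carrier (homology k (?X l))"
    for l l' and w :: "('v, 'f) hclass"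
  proof -
    have "incl_map k (Y l') (incl_map k (Y l) w) = incl_map k (Y l') w"
      using l w XY Ymono[OF l] Y by (intro incl_map_incl_map) auto
    also have "\<dots> = incl_map k (Y l') (incl_map k (?X l') w)"
      using l w XY cplx mono[of l l'] Y by (intro incl_map_incl_map[symmetric]) auto
    finally show ?thesis .
  qed
  have alg: "alg_extensions_at k N (Z \<psi>) Y B \<F> S f l = incl_map k (Y l) ` level_restrictions l"
    if "l \<in> p_params N B S" "l \<le> N" for l
    using that p_params_ge[OF that(1)] ell0_ge_1
    by (simp add: alg_extensions_at_def alg_restrictions_eq[OF _ _ refl])
  show ?thesis
  proof (intro subset_antisym subrelI)
    fix l' y assume "(l', y) \<in> cycle_extensions k N (Z \<psi>) Y \<tau>"
    then obtain w where l': "l' \<in> {1..N}" and w: "w \<in> level_restrictions l'"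
      and y: "y = incl_map k (Y l') w"
      by (auto simp: cycle_extensions_def extensions_at_def restr)
    obtain l v where l: "l \<in> p_params N B S" "l \<le> l'" and v: "v \<in> level_restrictions l"
      and wv: "w = incl_map k (?X l') v"
      using restriction_from_p_params[OF l' w] by blast
    have l1: "1 \<le> l" using p_params_ge[OF l(1)] ell0_ge_1 by linarith
    have "y = incl_map k (Y l') (incl_map k (Y l) v)"
      unfolding y wv using l l' l1 v by (intro square[symmetric]) (auto simp: level_restrictions_def)
    moreover have "(l, incl_map k (Y l) v) \<in> alg_extensions k N (Z \<psi>) Y B \<F> S f"
      using alg[OF l(1)] l l' v by (auto simp: alg_extensions_def)
    moreover have "y \<in> carrier (homology k (Y l'))"
      unfolding y using w l' cplx XY Y
      by (intro incl_map_closed[of "?X l'"]) (auto simp: level_restrictions_def)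
    ultimately show "(l', y) \<in> forward_closure k N Y (p_params N B S)
        (alg_extensions k N (Z \<psi>) Y B \<F> S f)"
      using l l' by (auto simp: forward_closure_def)
  next
    fix l' y assume "(l', y) \<in> forward_closure k N Y (p_params N B S)
        (alg_extensions k N (Z \<psi>) Y B \<F> S f)"
    then obtain l u where l': "l' \<in> {1..N}" and l: "l \<in> p_params N B S" "l \<le> l'"
      and u: "u \<in> alg_extensions_at k N (Z \<psi>) Y B \<F> S f l" and y: "y = incl_map k (Y l') u"
      by (auto simp: forward_closure_def alg_extensions_def)
    obtain v where v: "v \<in> level_restrictions l" and uv: "u = incl_map k (Y l) v"
      using u alg[OF l(1)] l l' by auto
    have l1: "1 \<le> l" using p_params_ge[OF l(1)] ell0_ge_1 by linarith
    have "y = incl_map k (Y l') (incl_map k (?X l') v)"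
      unfolding y uv using l l' l1 v by (intro square) (auto simp: level_restrictions_def)
    moreover have "incl_map k (?X l') v \<in> level_restrictions l'"
      using l l' l1 v by (intro restriction_transport) auto
    ultimately show "(l', y) \<in> cycle_extensions k N (Z \<psi>) Y \<tau>"
      using l' by (auto simp: cycle_extensions_def extensions_at_def restr)
  qed
qed

end
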